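(* Let $L$ be an even self-dual lattice with basis $\{v_i\}$ and Gram matrix $G$, let $g\in\mathrm{Aut}(L)$, and let $\epsilon(\alpha,\beta)=(-1)^{(\alpha\overline G,\beta)}$ for $\alpha,\beta\in L$. Then the general solution $\eta_g:L\to\mathbb C^*$ of $$\eta_g(\alpha)\eta_g(\beta)\epsilon(\alpha,\beta)=\eta_g(\alpha+\beta)\epsilon(\alpha g,\beta g)\qquad(\alpha,\beta\in L)$$ is given, for $\alpha=\sum_in_iv_i\in L$, by $$\eta_g(\alpha)=\prod_i\eta_g(v_i)^{n_i}\Big(\frac{\epsilon(v_i,v_i)}{\epsilon(v_ig,v_ig)}\Big)^{\frac{n_i(n_i-1)}2}\prod_{i>j}\Big(\frac{\epsilon(v_i,v_j)}{\epsilon(v_ig,v_jg)}\Big)^{n_in_j} =(-1)^{\left(\alpha\,\overline{(\overline G-g\overline Gg^{\mathrm T})},\,\alpha\right)}\prod_i\Big(\eta_g(v_i)\Big(\frac{\epsilon(v_i,v_i)}{\epsilon(v_ig,v_ig)}\Big)^{-\frac12}\Big)^{n_i},$$ where the values $\eta_g(v_i)\in\mathbb C^*$ can be chosen freely.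
   Context: Vectors of $L$ are identified with integer row vectors of coordinates with respect to $\{v_i\}$; matrices act on the right of row vectors, and $g$ also denotes the integer matrix of the automorphism, so $gGg^{\mathrm T}=G$. $(\cdot,\cdot)$ is the standard Euclidean inner product of coordinate vectors, so the inner product of $L$ is $\langle\alpha|\beta\rangle=(\alpha G,\beta)$. For a square matrix $M$, $\overline M$ is the lower triangular matrix with $\overline M_{i,j}=M_{i,j}$ for $i>j$, $\overline M_{i,i}=\frac12M_{i,i}$, and $\overline M_{i,j}=0$ for $i<j$. Note $\epsilon$ takes values $\pm1$. The power $(\cdot)^{-1/2}$ of the number $1$ is understood to be $1$ (the ratios $\epsilon(v_i,v_i)/\epsilon(v_ig,v_ig)$ are equal to $1$). *)

theory Defs
  imports "HOL-Analysis.Analysis"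
begin

text \<open>
  A lattice is the integer span \<open>L\<close> of a basis of a real vector space carrying a nondegenerate
  symmetric bilinear form \<open>B\<close>. The form is not required to be definite, so both Euclidean and
  Lorentzian lattices are covered.
\<close>

definition lattice_form :: "('a::real_vector \<Rightarrow> 'a \<Rightarrow> real) \<Rightarrow> bool" where
  "lattice_form B \<longleftrightarrow> bilinear B \<and> (\<forall>x y. B x y = B y x) \<and> (\<forall>x. (\<forall>y. B x y = 0) \<longrightarrow> x = 0)"

definition int_comb :: "('n::finite \<Rightarrow> 'a::real_vector) \<Rightarrow> int^'n \<Rightarrow> 'a" where
  "int_comb v n = (\<Sum>i\<in>UNIV. real_of_int (n $ i) *\<^sub>R v i)"

definition lattice_basis :: "('n::finite \<Rightarrow> 'a::real_vector) \<Rightarrow> 'a set \<Rightarrow> bool" where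
  "lattice_basis v L \<longleftrightarrow>
     inj v \<and> independent (range v) \<and> span (range v) = UNIV \<and> L = range (int_comb v)"

definition even_lattice :: "('a \<Rightarrow> 'a \<Rightarrow> real) \<Rightarrow> 'a set \<Rightarrow> bool" where
  "even_lattice B L \<longleftrightarrow> (\<forall>x\<in>L. \<exists>k::int. B x x = 2 * of_int k)"

definition dual_lattice :: "('a \<Rightarrow> 'a \<Rightarrow> real) \<Rightarrow> 'a set \<Rightarrow> 'a set" where
  "dual_lattice B L = {x. \<forall>y\<in>L. B x y \<in> \<int>}"

definition self_dual_lattice :: "('a \<Rightarrow> 'a \<Rightarrow> real) \<Rightarrow> 'a set \<Rightarrow> bool" where
  "self_dual_lattice B L \<longleftrightarrow> dual_lattice B L = L"

text \<open>Only the values on \<open>L\<close> of an automorphism matter; the image of \<open>\<alpha>\<close>, usually written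
  \<open>\<alpha>g\<close>, is \<open>g \<alpha>\<close>.\<close>

definition lattice_aut :: "('a::real_vector \<Rightarrow> 'a \<Rightarrow> real) \<Rightarrow> 'a set \<Rightarrow> ('a \<Rightarrow> 'a) set" where
  "lattice_aut B L = {g. bij_betw g L L \<and> (\<forall>x\<in>L. \<forall>y\<in>L. g (x + y) = g x + g y) \<and>
     (\<forall>x\<in>L. \<forall>y\<in>L. B (g x) (g y) = B x y)}"

definition coords :: "('n::finite \<Rightarrow> 'a::real_vector) \<Rightarrow> 'a \<Rightarrow> real^'n" where
  "coords v \<alpha> = (\<chi> i. real_of_int (inv (int_comb v) \<alpha> $ i))"

definition gram :: "('a \<Rightarrow> 'a \<Rightarrow> real) \<Rightarrow> ('n::finite \<Rightarrow> 'a) \<Rightarrow> real^'n^'n" where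
  "gram B v = (\<chi> i j. B (v i) (v j))"

text \<open>Rows are the coordinates of the images of the basis vectors: matrices act on row vectors
  from the right.\<close>

definition aut_matrix :: "('n::finite \<Rightarrow> 'a::real_vector) \<Rightarrow> ('a \<Rightarrow> 'a) \<Rightarrow> real^'n^'n" where
  "aut_matrix v g = (\<chi> i. coords v (g (v i)))"

definition lower_half ::
    "((real, 'n::{finite,linorder}) vec, 'n) vec \<Rightarrow> ((real, 'n) vec, 'n) vec" where
  "lower_half M = (\<chi> i j. if i > j then M $ i $ j else if i = j then M $ i $ i / 2 else 0)"

text \<open>All exponents of \<open>-1\<close> that occur are integers, for which \<open>powr\<close> (the principal branch)
  is the ordinary integer power.\<close>

definition minus_one_pow :: "real \<Rightarrow> complex" where
  "minus_one_pow x = (-1) powr complex_of_real x"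

definition eps ::
    "('a::real_vector \<Rightarrow> 'a \<Rightarrow> real) \<Rightarrow> ('n::{finite,linorder} \<Rightarrow> 'a) \<Rightarrow> 'a \<Rightarrow> 'a \<Rightarrow> complex" where
  "eps B v \<alpha> \<beta> = minus_one_pow ((coords v \<alpha> v* lower_half (gram B v)) \<bullet> coords v \<beta>)"

definition eps_ratio ::
    "('a::real_vector \<Rightarrow> 'a \<Rightarrow> real) \<Rightarrow> ('n::{finite,linorder} \<Rightarrow> 'a) \<Rightarrow> ('a \<Rightarrow> 'a) \<Rightarrow> 'n \<Rightarrow> 'n \<Rightarrow> complex" where
  "eps_ratio B v g i j = eps B v (v i) (v j) / eps B v (g (v i)) (g (v j))"

text \<open>Maps from \<open>L\<close> to the nonzero complex numbers are extensional functions, so that equality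
  of solutions is equality on \<open>L\<close>.\<close>

definition eta_solutions ::
    "('a::real_vector \<Rightarrow> 'a \<Rightarrow> real) \<Rightarrow> ('n::{finite,linorder} \<Rightarrow> 'a) \<Rightarrow> 'a set \<Rightarrow> ('a \<Rightarrow> 'a)
       \<Rightarrow> ('a \<Rightarrow> complex) set" where
  "eta_solutions B v L g = {\<eta> \<in> L \<rightarrow>\<^sub>E (- {0}). \<forall>\<alpha>\<in>L. \<forall>\<beta>\<in>L.
     \<eta> \<alpha> * \<eta> \<beta> * eps B v \<alpha> \<beta> = \<eta> (\<alpha> + \<beta>) * eps B v (g \<alpha>) (g \<beta>)}"

text \<open>The two closed formulas, for the value at \<open>int_comb v n\<close>, with prescribed values \<open>c i\<close> at
  the basis vectors. The division by 2 in the exponent is exact.\<close>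

definition eta_product ::
    "('a::real_vector \<Rightarrow> 'a \<Rightarrow> real) \<Rightarrow> ('n::{finite,linorder} \<Rightarrow> 'a) \<Rightarrow> ('a \<Rightarrow> 'a)
       \<Rightarrow> ('n \<Rightarrow> complex) \<Rightarrow> (int, 'n) vec \<Rightarrow> complex" where
  "eta_product B v g c n =
     (\<Prod>i\<in>UNIV. c i powi (n $ i) * eps_ratio B v g i i powi (n $ i * (n $ i - 1) div 2)) *
     (\<Prod>(i, j)\<in>{(i, j). i > j}. eps_ratio B v g i j powi (n $ i * n $ j))"

definition eta_sign ::
    "('a::real_vector \<Rightarrow> 'a \<Rightarrow> real) \<Rightarrow> ('n::{finite,linorder} \<Rightarrow> 'a) \<Rightarrow> ('a \<Rightarrow> 'a)
       \<Rightarrow> ('n \<Rightarrow> complex) \<Rightarrow> (int, 'n) vec \<Rightarrow> complex" where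
  "eta_sign B v g c n =
     (let a = (\<chi> i. real_of_int (n $ i)); M = aut_matrix v g; H = lower_half (gram B v)
      in minus_one_pow ((a v* lower_half (H - M ** H ** transpose M)) \<bullet> a) *
         (\<Prod>i\<in>UNIV. (c i * eps_ratio B v g i i powr (- 1 / 2)) powi (n $ i)))"

end

theory Submission
  imports Defs
begin

text \<open>
  The exponent of \<open>\<epsilon>(\<alpha>,\<beta>) / \<epsilon>(\<alpha>g,\<beta>g)\<close> is a biadditive integer-valued form \<open>D\<close>. The symmetrisation of
  the exponent of \<open>\<epsilon>\<close> is the inner product, which \<open>g\<close> preserves, so \<open>D\<close> is alternating. Hence its
  strictly lower triangular part is a quadratic form whose polarisation is congruent to \<open>D\<close> modulo 2:
  this gives one solution of the functional equation, and any two solutions differ by a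
  homomorphism \<open>L \<rightarrow> \<complex>\<^sup>*\<close>, which is determined by its values on the basis.
\<close>

section \<open>Additive and multiplicative functions on integer vectors\<close>

text \<open>Unit steps up and down along one axis reach every integer multiple of a unit vector, and
  a vector is the finite sum of its axis components.\<close>

lemma int_vec_induct [case_names zero add diff]:
  fixes n :: "int^'n::finite"
  assumes zero: "P 0"
    and add: "\<And>x i. P x \<Longrightarrow> P (x + axis i 1)"
    and diff: "\<And>x i. P x \<Longrightarrow> P (x - axis i 1)"
  shows "P n"
proof -
  have axis_step: "P (x + axis i k)" if "P x" for x i and k :: int
  proof (induction k rule: int_induct[where k = 0])
    case base
    then show ?case using that by (simp add: axis_def zero_vec_def[symmetric])
  next
    case (step1 k)
    have "x + axis i (k + 1) = (x + axis i k) + axis i 1"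
      by (simp add: vec_eq_iff axis_def)
    with add[OF step1(2), of i] show ?case by (simp only:)
  next
    case (step2 k)
    have "x + axis i (k - 1) = (x + axis i k) - axis i 1"
      by (simp add: vec_eq_iff axis_def)
    with diff[OF step2(2), of i] show ?case by (simp only:)
  qed
  have "P (\<Sum>i\<in>S. axis i (n $ i))" if "finite S" for S
    using that
  proof (induction S rule: finite_induct)
    case (insert i S)
    then show ?case
      using axis_step[of "\<Sum>i\<in>S. axis i (n $ i)" i "n $ i"] by (simp add: add.commute)
  qed (simp add: zero)
  moreover have "(\<Sum>i\<in>UNIV. axis i (n $ i)) = n"
    by (simp add: vec_eq_iff axis_def sum.delta')
  ultimately show ?thesis by (metis finite_class.finite_UNIV)
qed

lemma additive_int_vec:
  fixes f :: "int^'n::finite \<Rightarrow> int"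
  assumes add: "\<And>x y. f (x + y) = f x + f y"
  shows "f n = (\<Sum>i\<in>UNIV. n $ i * f (axis i 1))"
proof (induction n rule: int_vec_induct)
  case zero
  have "f 0 = 0" using add[of 0 0] by simp
  then show ?case by simp
next
  case (add x i)
  have "(\<Sum>k\<in>UNIV. (x + axis i 1) $ k * f (axis k 1)) =
      (\<Sum>k\<in>UNIV. x $ k * f (axis k 1)) + (\<Sum>k\<in>UNIV. if k = i then f (axis k 1) else 0)"
    unfolding sum.distrib[symmetric] by (rule sum.cong) (auto simp: axis_def algebra_simps)
  then show ?case using add assms[of x "axis i 1"] by simp
next
  case (diff x i)
  have "(\<Sum>k\<in>UNIV. (x - axis i 1) $ k * f (axis k 1)) =
      (\<Sum>k\<in>UNIV. x $ k * f (axis k 1)) - (\<Sum>k\<in>UNIV. if k = i then f (axis k 1) else 0)"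
    unfolding sum_subtractf[symmetric] by (rule sum.cong) (auto simp: axis_def algebra_simps)
  then show ?case using diff assms[of "x - axis i 1" "axis i 1"] by simp
qed

text \<open>To be applied to the quotient of two solutions: it shows that a solution is determined
  by its values on the basis.\<close>

lemma multiplicative_int_vec_eq_one:
  fixes f :: "int^'n::finite \<Rightarrow> complex"
  assumes mult: "\<And>x y. f (x + y) = f x * f y"
    and basis: "\<And>i. f (axis i 1) = 1"
  shows "f n = 1"
proof (induction n rule: int_vec_induct)
  case zero
  \<comment> \<open>\<open>undefined\<close> is just some index. Cancelling the value 1 there gives
    \<open>f 0 = 1\<close>, whereas \<open>0 + 0\<close> would leave \<open>f 0 = 0\<close>
    possible.\<close>
  have "f (axis undefined 1) = f (axis undefined 1) * f 0"
    using mult[of "axis undefined 1" 0] by simp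
  then show ?case by (simp add: basis)
next
  case (add x i)
  then show ?case by (simp add: mult basis)
next
  case (diff x i)
  then show ?case using mult[of "x - axis i 1" "axis i 1"] by (simp add: basis)
qed

section \<open>Sums over pairs of indices and powers of -1\<close>

text \<open>The strict upper triangle is transposed onto the strict lower one. This compares full
  bilinear sums with the sums over \<open>i > j\<close> in the closed formulas.\<close>

lemma sum_square_split:
  fixes f :: "'n::{finite,linorder} \<Rightarrow> 'n \<Rightarrow> 'b::comm_monoid_add"
  shows "(\<Sum>i\<in>UNIV. \<Sum>j\<in>UNIV. f i j) =
    (\<Sum>(i, j)\<in>{(i, j). i > j}. f i j + f j i) + (\<Sum>i\<in>UNIV. f i i)"
proof -
  let ?lo = "{(i, j). i > j} :: ('n \<times> 'n) set"
  let ?up = "{(i, j). i < j} :: ('n \<times> 'n) set"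
  let ?di = "range (\<lambda>i. (i, i)) :: ('n \<times> 'n) set"
  have UNIV_eq: "(UNIV :: ('n \<times> 'n) set) = (?lo \<union> ?up) \<union> ?di"
    by (auto simp: image_iff)
  have "(\<Sum>i\<in>UNIV. \<Sum>j\<in>UNIV. f i j) = (\<Sum>(i, j)\<in>UNIV. f i j)"
    by (simp add: sum.cartesian_product)
  also have "\<dots> = (\<Sum>(i, j)\<in>?lo. f i j) + (\<Sum>(i, j)\<in>?up. f i j) + (\<Sum>(i, j)\<in>?di. f i j)"
    unfolding UNIV_eq by (subst sum.union_disjoint; (subst sum.union_disjoint)?; auto)
  also have "(\<Sum>(i, j)\<in>?up. f i j) = (\<Sum>(i, j)\<in>?lo. f j i)"
    by (rule sum.reindex_bij_witness[of _ prod.swap prod.swap]) auto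
  also have "(\<Sum>(i, j)\<in>?di. f i j) = (\<Sum>i\<in>UNIV. f i i)"
    by (subst sum.reindex) (auto simp: inj_on_def)
  finally show ?thesis by (simp add: sum.distrib case_prod_unfold)
qed

lemma power_int_sum_exponents:
  fixes x :: "'b::field"
  assumes "x \<noteq> 0"
  shows "x powi (\<Sum>i\<in>A. f i) = (\<Prod>i\<in>A. x powi f i)"
  by (induction A rule: infinite_finite_induct) (simp_all add: power_int_add assms)

lemma minus_one_powi_cong:
  assumes "even (a - b)"
  shows "(-1 :: complex) powi a = (-1) powi b"
  using assms by (auto simp: power_int_minus_left)

lemma minus_one_pow_of_int: "minus_one_pow (of_int k) = (-1) powi k"
  unfolding minus_one_pow_def using complex_powr_of_int[of "-1" k] by simp

section \<open>Coordinates and matrices\<close>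

lemma int_comb_add: "int_comb v (m + n) = int_comb v m + int_comb v n"
  by (simp add: int_comb_def scaleR_add_left sum.distrib)

lemma int_comb_axis: "int_comb v (axis i 1) = v i"
proof -
  have "int_comb v (axis i 1) = (\<Sum>k\<in>UNIV. if k = i then v k else 0)"
    unfolding int_comb_def by (rule sum.cong) (auto simp: axis_def)
  then show ?thesis by simp
qed

lemma inj_int_comb:
  assumes "inj v" "independent (range v)"
  shows "inj (int_comb v)"
proof (rule injI)
  fix m n assume eq: "int_comb v m = int_comb v n"
  \<comment> \<open>\<open>independentD\<close> wants coefficients indexed by vectors, so the
    coordinate differences are transported along \<open>inv v\<close>.\<close>
  let ?u = "\<lambda>x. real_of_int (m $ inv v x) - real_of_int (n $ inv v x)"
  have "(\<Sum>x\<in>range v. ?u x *\<^sub>R x) = (\<Sum>i\<in>UNIV. ?u (v i) *\<^sub>R v i)"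
    using assms(1) by (simp add: sum.reindex)
  also have "\<dots> = 0"
    using eq assms(1) by (simp add: int_comb_def scaleR_diff_left sum_subtractf)
  finally have "?u (v i) = 0" for i
    using independentD[OF assms(2), of "range v" ?u "v i"] by auto
  then show "m = n"
    using assms(1) by (simp add: vec_eq_iff)
qed

lemma vector_matrix_inner:
  fixes A :: "real^'n^'n"
  shows "(x v* A) \<bullet> y = (\<Sum>i\<in>UNIV. \<Sum>j\<in>UNIV. A $ i $ j * x $ i * y $ j)"
proof -
  have "(x v* A) \<bullet> y = (\<Sum>j\<in>UNIV. \<Sum>i\<in>UNIV. A $ i $ j * x $ i * y $ j)"
    by (simp add: inner_vec_def vector_matrix_mult_def sum_distrib_left sum_distrib_right mult_ac)
  also have "\<dots> = (\<Sum>i\<in>UNIV. \<Sum>j\<in>UNIV. A $ i $ j * x $ i * y $ j)"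
    by (rule sum.swap)
  finally show ?thesis .
qed

text \<open>The rows of \<open>aut_matrix v g\<close> are the coordinates of the images of the
  basis, so this will identify the entries of the conjugated matrix with exponents of
  \<open>eps\<close> at these images.\<close>

lemma conjugated_matrix_entry:
  fixes A M :: "real^'n^'n"
  shows "(M ** A ** transpose M) $ i $ j = (M $ i v* A) \<bullet> M $ j"
  by (simp add: matrix_matrix_mult_def vector_matrix_mult_def transpose_def inner_vec_def mult_ac)

section \<open>The integer exponents of \<open>eps\<close> and of its ratio under
  \<open>g\<close>\<close>

locale even_unimodular_automorphism =
  fixes B :: "'a::real_vector \<Rightarrow> 'a \<Rightarrow> real"
    and L :: "'a set"
    and v :: "'n::{finite,linorder} \<Rightarrow> 'a"
    and g :: "'a \<Rightarrow> 'a"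
  assumes form: "lattice_form B"
    and basis: "lattice_basis v L"
    and even_L: "even_lattice B L"
    and self_dual: "self_dual_lattice B L"
    and aut: "g \<in> lattice_aut B L"
begin

lemma L_eq: "L = range (int_comb v)"
  using basis by (simp add: lattice_basis_def)

lemma int_comb_in_L: "int_comb v n \<in> L"
  by (simp add: L_eq)

lemma basis_in_L: "v i \<in> L"
  using int_comb_in_L[of "axis i 1"] by (simp add: int_comb_axis)

lemma inj_comb: "inj (int_comb v)"
  using basis by (auto simp: lattice_basis_def intro: inj_int_comb)

lemma coords_int_comb: "coords v (int_comb v n) = (\<chi> i. real_of_int (n $ i))"
  by (simp add: coords_def inj_comb)

text \<open>The floor only changes the type, since the entries are shown to be integers
  next.\<close>

definition half_gram :: "'n \<Rightarrow> 'n \<Rightarrow> int" where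
  "half_gram i j = \<lfloor>lower_half (gram B v) $ i $ j\<rfloor>"

text \<open>Self-duality places \<open>L\<close> inside its dual, so Gram entries are integers;
  evenness makes the halved diagonal integral.\<close>

lemma of_int_half_gram: "lower_half (gram B v) $ i $ j = of_int (half_gram i j)"
proof -
  have "B (v i) (v j) \<in> \<int>"
    using self_dual basis_in_L by (auto simp: self_dual_lattice_def dual_lattice_def)
  moreover have "B (v i) (v i) / 2 \<in> \<int>"
    using even_L basis_in_L[of i] by (auto simp: even_lattice_def)
  ultimately have "lower_half (gram B v) $ i $ j \<in> \<int>"
    by (cases "i = j") (simp_all add: lower_half_def gram_def)
  then show ?thesis by (simp add: half_gram_def)
qed

lemma half_gram_sym: "of_int (half_gram i j) + of_int (half_gram j i) = B (v i) (v j)"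
proof -
  have "B (v i) (v j) = B (v j) (v i)"
    using form by (simp add: lattice_form_def)
  then show ?thesis
    unfolding of_int_half_gram[symmetric]
    by (cases i j rule: linorder_cases) (simp_all add: lower_half_def gram_def, auto)
qed

definition eps_exp :: "(int, 'n) vec \<Rightarrow> (int, 'n) vec \<Rightarrow> int" where
  "eps_exp m n = (\<Sum>i\<in>UNIV. \<Sum>j\<in>UNIV. half_gram i j * m $ i * n $ j)"

lemma eps_exp_add_left: "eps_exp (x + y) z = eps_exp x z + eps_exp y z"
  by (simp add: eps_exp_def algebra_simps sum.distrib)

lemma eps_exp_add_right: "eps_exp z (x + y) = eps_exp z x + eps_exp z y"
  by (simp add: eps_exp_def algebra_simps sum.distrib)

lemma eps_exp_axis: "eps_exp (axis i 1) (axis j 1) = half_gram i j"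
proof -
  have "eps_exp (axis i 1) (axis j 1) =
      (\<Sum>k\<in>UNIV. \<Sum>l\<in>UNIV. if l = j then if k = i then half_gram k l else 0 else 0)"
    unfolding eps_exp_def by (intro sum.cong refl) (simp add: axis_def)
  then show ?thesis by simp
qed

lemma of_int_eps_exp:
  "of_int (eps_exp m n) =
     (coords v (int_comb v m) v* lower_half (gram B v)) \<bullet> coords v (int_comb v n)"
  by (simp add: vector_matrix_inner coords_int_comb of_int_half_gram eps_exp_def)

lemma eps_int_comb: "eps B v (int_comb v m) (int_comb v n) = (-1) powi eps_exp m n"
  by (simp add: eps_def of_int_eps_exp[symmetric] minus_one_pow_of_int)

text \<open>Halving the diagonal makes the lower triangular matrix plus its transpose equal to the
  Gram matrix; this is the bilinear extension.\<close>

lemma eps_exp_sym: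
  "of_int (eps_exp m n) + of_int (eps_exp n m) = B (int_comb v m) (int_comb v n)"
proof -
  have bil: "bilinear B" using form by (simp add: lattice_form_def)
  have "B (int_comb v m) (int_comb v n) =
      (\<Sum>i\<in>UNIV. \<Sum>j\<in>UNIV. of_int (m $ i) * (of_int (n $ j) * B (v i) (v j)))"
    unfolding int_comb_def
    by (simp add: bilinear_sum[OF bil] bilinear_lmul[OF bil] bilinear_rmul[OF bil]
        sum.cartesian_product mult_ac)
  moreover have "real_of_int (eps_exp n m) =
      (\<Sum>i\<in>UNIV. \<Sum>j\<in>UNIV. of_int (half_gram j i) * of_int (m $ i) * of_int (n $ j))"
    unfolding eps_exp_def by (subst sum.swap) (simp add: mult_ac)
  ultimately show ?thesis
    by (simp add: eps_exp_def half_gram_sym[symmetric] sum.distrib[symmetric] algebra_simps)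
qed

definition g_coords :: "(int, 'n) vec \<Rightarrow> (int, 'n) vec" where
  "g_coords n = inv (int_comb v) (g (int_comb v n))"

lemma int_comb_g_coords: "int_comb v (g_coords n) = g (int_comb v n)"
proof -
  have "g (int_comb v n) \<in> range (int_comb v)"
    using aut int_comb_in_L[of n] by (auto simp: lattice_aut_def bij_betw_def L_eq)
  then show ?thesis by (simp add: g_coords_def f_inv_into_f)
qed

lemma g_coords_add: "g_coords (m + n) = g_coords m + g_coords n"
proof -
  have "int_comb v (g_coords (m + n)) = int_comb v (g_coords m + g_coords n)"
    using aut int_comb_in_L by (simp add: int_comb_g_coords int_comb_add lattice_aut_def)
  then show ?thesis using inj_comb by (simp add: inj_eq)
qed

text \<open>The biadditive form of the overview. The abbreviation \<open>D\<close> below denotes its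
  matrix in the basis.\<close>

definition ratio_exp :: "(int, 'n) vec \<Rightarrow> (int, 'n) vec \<Rightarrow> int" where
  "ratio_exp m n = eps_exp m n - eps_exp (g_coords m) (g_coords n)"

abbreviation D :: "'n \<Rightarrow> 'n \<Rightarrow> int" where
  "D i j \<equiv> ratio_exp (axis i 1) (axis j 1)"

text \<open>Symmetrising both exponents gives values of \<open>B\<close> that agree because
  \<open>g\<close> preserves \<open>B\<close>. The identity holds over the integers, not just modulo
  2, so the diagonal vanishes as well.\<close>

lemma ratio_exp_antisym: "ratio_exp n m = - ratio_exp m n"
proof -
  have "B (g (int_comb v m)) (g (int_comb v n)) = B (int_comb v m) (int_comb v n)"
    using aut int_comb_in_L by (simp add: lattice_aut_def)
  then have "real_of_int (eps_exp (g_coords m) (g_coords n) + eps_exp (g_coords n) (g_coords m)) =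
      real_of_int (eps_exp m n + eps_exp n m)"
    by (simp add: eps_exp_sym int_comb_g_coords)
  then show ?thesis unfolding ratio_exp_def of_int_eq_iff by simp
qed

lemma ratio_exp_self: "ratio_exp m m = 0"
  using ratio_exp_antisym[of m m] by simp

lemma ratio_exp_expand: "ratio_exp m n = (\<Sum>i\<in>UNIV. \<Sum>j\<in>UNIV. D i j * m $ i * n $ j)"
proof -
  have "ratio_exp m n = (\<Sum>i\<in>UNIV. m $ i * ratio_exp (axis i 1) n)"
    by (rule additive_int_vec) (simp add: ratio_exp_def eps_exp_add_left g_coords_add)
  also have "\<dots> = (\<Sum>i\<in>UNIV. m $ i * (\<Sum>j\<in>UNIV. n $ j * D i j))"
  proof (rule sum.cong, rule refl)
    fix i :: 'n
    have "ratio_exp (axis i 1) n = (\<Sum>j\<in>UNIV. n $ j * D i j)"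
      by (rule additive_int_vec) (simp add: ratio_exp_def eps_exp_add_right g_coords_add)
    then show "m $ i * ratio_exp (axis i 1) n = m $ i * (\<Sum>j\<in>UNIV. n $ j * D i j)"
      by simp
  qed
  finally show ?thesis by (simp add: sum_distrib_left mult_ac)
qed

lemma eps_quotient:
  "eps B v (int_comb v m) (int_comb v n) / eps B v (g (int_comb v m)) (g (int_comb v n)) =
     (-1) powi ratio_exp m n"
  by (simp add: int_comb_g_coords[symmetric] eps_int_comb ratio_exp_def power_int_diff)

lemma eps_ratio_basis: "eps_ratio B v g i j = (-1) powi D i j"
  using eps_quotient[of "axis i 1" "axis j 1"] by (simp add: eps_ratio_def int_comb_axis)

text \<open>This removes the diagonal factors from both closed formulas, including the power with
  exponent \<open>- 1 / 2\<close>.\<close>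

lemma eps_ratio_diag: "eps_ratio B v g i i = 1"
  by (simp add: eps_ratio_basis ratio_exp_self)

section \<open>The quadratic form in the sign and its polarisation\<close>

definition lower_form :: "(int, 'n) vec \<Rightarrow> int" where
  "lower_form n = (\<Sum>(i, j)\<in>{(i, j). i > j}. D i j * n $ i * n $ j)"

text \<open>The polarisation has terms \<open>D i j * (m $ i * n $ j + m $ j * n $ i)\<close>. By
  antisymmetry \<open>ratio_exp\<close> has the same terms with a minus sign, so they differ by even
  numbers.\<close>

lemma lower_form_polarisation:
  "even (lower_form (m + n) - (lower_form m + lower_form n + ratio_exp m n))"
proof -
  have "ratio_exp m n = (\<Sum>(i, j)\<in>{(i, j). i > j}. D i j * m $ i * n $ j + D j i * m $ j * n $ i)"
    unfolding ratio_exp_expand[of m n] sum_square_split by (simp add: ratio_exp_self)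
  also have "\<dots> = (\<Sum>(i, j)\<in>{(i, j). i > j}. D i j * (m $ i * n $ j - m $ j * n $ i))"
  proof (rule sum.cong, safe)
    fix i j :: 'n
    have "D j i = - D i j" by (rule ratio_exp_antisym)
    then show "D i j * m $ i * n $ j + D j i * m $ j * n $ i =
        D i j * (m $ i * n $ j - m $ j * n $ i)"
      by (simp add: algebra_simps)
  qed
  finally have "lower_form (m + n) - (lower_form m + lower_form n + ratio_exp m n) =
      (\<Sum>(i, j)\<in>{(i, j). i > j}. 2 * (D i j * m $ j * n $ i))"
    by (simp add: lower_form_def sum_subtractf[symmetric] sum.distrib[symmetric] case_prod_unfold
        algebra_simps)
  then show ?thesis by (auto intro: dvd_sum)
qed

lemma lower_form_axis: "lower_form (axis i 1) = 0"
  unfolding lower_form_def by (rule sum.neutral) (auto simp: axis_def)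

section \<open>The two closed formulas\<close>

lemma eta_product_eq:
  "eta_product B v g c n = (\<Prod>i\<in>UNIV. c i powi (n $ i)) * (-1) powi lower_form n"
proof -
  have "(\<Prod>(i, j)\<in>{(i, j). i > j}. eps_ratio B v g i j powi (n $ i * n $ j)) = (-1) powi lower_form n"
    unfolding lower_form_def
    by (subst power_int_sum_exponents)
      (auto simp: eps_ratio_basis power_int_mult case_prod_unfold mult.assoc)
  then show ?thesis by (simp add: eta_product_def eps_ratio_diag)
qed

lemma eta_product_nonzero: "(\<And>i. c i \<noteq> 0) \<Longrightarrow> eta_product B v g c n \<noteq> 0"
  by (simp add: eta_product_eq)

text \<open>The powers of the nonzero \<open>c i\<close> are multiplicative in the vector; the
  polarisation of the sign supplies the remaining factor.\<close>

lemma eta_product_add: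
  assumes "\<And>i. c i \<noteq> 0"
  shows "eta_product B v g c (m + n) =
    eta_product B v g c m * eta_product B v g c n * (-1) powi ratio_exp m n"
proof -
  have "(-1 :: complex) powi lower_form (m + n) = (-1) powi (lower_form m + lower_form n + ratio_exp m n)"
    by (rule minus_one_powi_cong) (rule lower_form_polarisation)
  then show ?thesis
    using assms by (simp add: eta_product_eq power_int_add prod.distrib)
qed

lemma eta_product_axis: "eta_product B v g c (axis i 1) = c i"
proof -
  have "(\<Prod>k\<in>UNIV. c k powi (axis i 1 $ k)) = (\<Prod>k\<in>UNIV. if k = i then c k else 1)"
    by (rule prod.cong) (auto simp: axis_def)
  then show ?thesis by (simp add: eta_product_eq lower_form_axis)
qed

lemma eta_product_eq_eta_sign: "eta_product B v g c n = eta_sign B v g c n"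
proof -
  define H where "H = lower_half (gram B v)"
  define M where "M = aut_matrix v g"
  define a :: "(real, 'n) vec" where "a = (\<chi> i. real_of_int (n $ i))"
  \<comment> \<open>Row \<open>i\<close> of \<open>M\<close> is the coordinate vector of
    \<open>g (v i)\<close>, that is, \<open>g_coords (axis i 1)\<close>.\<close>
  have conj: "(H - M ** H ** transpose M) $ i $ j = of_int (D i j)" for i j
    using of_int_eps_exp[of "g_coords (axis i 1)" "g_coords (axis j 1)"]
    by (simp add: conjugated_matrix_entry M_def aut_matrix_def ratio_exp_def eps_exp_axis
        int_comb_g_coords int_comb_axis H_def of_int_half_gram)
  \<comment> \<open>The outer \<open>lower_half\<close> keeps half of the diagonal, which is zero by
    \<open>ratio_exp_self\<close>.\<close>
  have "(a v* lower_half (H - M ** H ** transpose M)) \<bullet> a =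
      (\<Sum>i\<in>UNIV. \<Sum>j\<in>UNIV. if i > j then of_int (D i j * n $ i * n $ j) else 0)"
    unfolding vector_matrix_inner
    by (intro sum.cong refl) (auto simp: lower_half_def conj ratio_exp_self a_def simp del: vector_minus_component)
  also have "\<dots> = of_int (lower_form n)"
    unfolding sum_square_split lower_form_def of_int_sum
    by (auto intro!: sum.cong)
  finally show ?thesis
    by (simp add: eta_sign_def Let_def H_def M_def a_def minus_one_pow_of_int eps_ratio_diag
        eta_product_eq)
qed

section \<open>Solutions of the functional equation\<close>

text \<open>Dividing by the nonzero \<open>eps\<close> at the images turns the equation into a
  twisted multiplicativity on integer coordinates.\<close>

lemma eta_equation_iff:
  "\<eta> \<in> eta_solutions B v L g \<longleftrightarrow> \<eta> \<in> L \<rightarrow>\<^sub>E (- {0}) \<and>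
    (\<forall>m n. \<eta> (int_comb v (m + n)) =
       \<eta> (int_comb v m) * \<eta> (int_comb v n) * (-1) powi ratio_exp m n)"
proof -
  have "eps B v (g (int_comb v m)) (g (int_comb v n)) \<noteq> 0" for m n
    by (simp add: int_comb_g_coords[symmetric] eps_int_comb)
  then have "x * eps B v (int_comb v m) (int_comb v n) =
      y * eps B v (g (int_comb v m)) (g (int_comb v n)) \<longleftrightarrow> y = x * (-1) powi ratio_exp m n" for x y m n
    unfolding eps_quotient[symmetric] by (auto simp: field_simps)
  then show ?thesis
    by (simp add: eta_solutions_def L_eq int_comb_add)
qed

lemma eta_basis_nonzero: "\<eta> \<in> L \<rightarrow>\<^sub>E (- {0}) \<Longrightarrow> \<eta> (v i) \<noteq> (0::complex)"
  using basis_in_L[of i] by (auto simp: PiE_iff)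

text \<open>A solution and the product formula built from its basis values acquire the same sign
  under addition, so their quotient is a homomorphism equal to 1 on the basis.\<close>

lemma eta_solutions_iff:
  assumes "\<eta> \<in> L \<rightarrow>\<^sub>E (- {0})"
  shows "\<eta> \<in> eta_solutions B v L g \<longleftrightarrow>
    (\<forall>n. \<eta> (int_comb v n) = eta_product B v g (\<lambda>i. \<eta> (v i)) n)"
proof
  assume "\<forall>n. \<eta> (int_comb v n) = eta_product B v g (\<lambda>i. \<eta> (v i)) n"
  then show "\<eta> \<in> eta_solutions B v L g"
    unfolding eta_equation_iff using assms eta_product_add eta_basis_nonzero[OF assms] by simp
next
  assume sol: "\<eta> \<in> eta_solutions B v L g"
  let ?p = "eta_product B v g (\<lambda>i. \<eta> (v i))"
  have nz: "?p n \<noteq> 0" for n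
    by (rule eta_product_nonzero) (rule eta_basis_nonzero[OF assms])
  have "\<eta> (int_comb v n) / ?p n = 1" for n
  proof (rule multiplicative_int_vec_eq_one)
    fix x y
    have "?p (x + y) = ?p x * ?p y * (-1) powi ratio_exp x y"
      by (rule eta_product_add) (rule eta_basis_nonzero[OF assms])
    moreover have "\<eta> (int_comb v (x + y)) =
       \<eta> (int_comb v x) * \<eta> (int_comb v y) * (-1) powi ratio_exp x y"
      using sol unfolding eta_equation_iff by blast
    ultimately show "\<eta> (int_comb v (x + y)) / ?p (x + y) =
        \<eta> (int_comb v x) / ?p x * (\<eta> (int_comb v y) / ?p y)"
      by simp
  next
    fix i
    show "\<eta> (int_comb v (axis i 1)) / ?p (axis i 1) = 1"
      using eta_basis_nonzero[OF assms] by (simp add: eta_product_axis int_comb_axis)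
  qed
  then show "\<forall>n. \<eta> (int_comb v n) = ?p n"
    using nz by simp
qed

lemma ex1_eta_solution:
  assumes c: "\<And>i. c i \<noteq> 0"
  shows "\<exists>!\<eta>. \<eta> \<in> eta_solutions B v L g \<and> (\<forall>i. \<eta> (v i) = c i)"
proof -
  \<comment> \<open>The product formula read off in coordinates; \<open>restrict\<close> makes it
    extensional, so that uniqueness on \<open>L\<close> gives equality of functions.\<close>
  define \<eta> where "\<eta> = restrict (\<lambda>x. eta_product B v g c (inv (int_comb v) x)) L"
  have val: "\<eta> (int_comb v n) = eta_product B v g c n" for n
    by (simp add: \<eta>_def int_comb_in_L inj_comb)
  have ext: "\<eta> \<in> L \<rightarrow>\<^sub>E (- {0})"
    using eta_product_nonzero[OF c] by (auto simp: \<eta>_def)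
  have \<eta>_basis: "\<eta> (v i) = c i" for i
    using val[of "axis i 1"] by (simp add: int_comb_axis eta_product_axis)
  have sol: "\<eta> \<in> eta_solutions B v L g"
    unfolding eta_solutions_iff[OF ext] by (simp add: val \<eta>_basis)
  show ?thesis
  proof (rule ex1I[of _ \<eta>])
    show "\<eta> \<in> eta_solutions B v L g \<and> (\<forall>i. \<eta> (v i) = c i)"
      using sol \<eta>_basis by simp
  next
    fix \<theta> assume \<theta>: "\<theta> \<in> eta_solutions B v L g \<and> (\<forall>i. \<theta> (v i) = c i)"
    then have \<theta>_ext: "\<theta> \<in> L \<rightarrow>\<^sub>E (- {0})" by (simp add: eta_solutions_def)
    have "\<theta> (int_comb v n) = \<eta> (int_comb v n)" for n
      using \<theta> eta_solutions_iff[OF \<theta>_ext] by (simp add: val)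
    then show "\<theta> = \<eta>"
      by (intro PiE_ext[OF \<theta>_ext ext]) (auto simp: L_eq)
  qed
qed

end

theorem theoremC2:
  fixes B :: "'a::real_vector \<Rightarrow> 'a \<Rightarrow> real"
    and L :: "'a set"
    and v :: "'n::{finite,linorder} \<Rightarrow> 'a"
    and g :: "'a \<Rightarrow> 'a"
  assumes "lattice_form B"
    and "lattice_basis v L"
    and "even_lattice B L"
    and "self_dual_lattice B L"
    and "g \<in> lattice_aut B L"
  shows "(\<forall>\<eta> \<in> L \<rightarrow>\<^sub>E (- {0}). \<eta> \<in> eta_solutions B v L g \<longleftrightarrow>
            (\<forall>n. \<eta> (int_comb v n) = eta_product B v g (\<lambda>i. \<eta> (v i)) n))
       \<and> (\<forall>c. (\<forall>i. c i \<noteq> 0) \<longrightarrow> (\<forall>n. eta_product B v g c n = eta_sign B v g c n))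
       \<and> (\<forall>c. (\<forall>i. c i \<noteq> 0) \<longrightarrow> (\<exists>!\<eta>. \<eta> \<in> eta_solutions B v L g \<and> (\<forall>i. \<eta> (v i) = c i)))"
proof -
  interpret even_unimodular_automorphism B L v g
    using assms by unfold_locales
  show ?thesis
    using eta_solutions_iff eta_product_eq_eta_sign ex1_eta_solution by blast
qed

end
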